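(* (i) For any $f\colon\omega\to\omega$, there exists a summable ideal $\mathcal I$ on $\omega$ such that $f\leq_{\mathrm{LT}}\mathcal I^*$, where $\mathcal I^*$ is the dual filter. (ii) There does not exist a filter $\mathcal F\subseteq\mathcal P(\omega)$ such that $k\leq_{\mathrm{LT}}\mathcal F$ for all Turing degree topologies $k$.
   Context: **Filters and ideals.** An upper set is a nonempty family $\mathcal U\subseteq\mathcal P(\omega)$, closed upwards under $\subseteq$, with $\emptyset\notin\mathcal U$. A filter is an upper set closed under finite intersections. An ideal $\mathcal I$ is a family whose dual $\mathcal I^*=\{\omega\setminus A:A\in\mathcal I\}$ is a filter. A summable ideal is an ideal of the form $\mathrm{Sum}_g=\{A\subseteq\omega:\sum_{n\in A}g(n)<\infty\}$ for some $g\colon\omega\to[0,\infty)$. **Upper sequences.** An upper sequence is a family $\overline{\mathcal U}=(\mathcal U_n)_{n\in I}$ of upper sets with $I\subseteq\omega$. An upper set is viewed as an upper sequence with a singleton index set (equivalently, as the constant sequence). A function $f\colon\omega\to\omega$ is viewed as the upper sequence whose $n$-th term is the principal ultrafilter $\{A\subseteq\omega:f(n)\in A\}$. A Turing degree topology is one associated with a decision problem $X\subseteq\omega$, i.e. with the characteristic function $\chi_X\colon\omega\to\{0,1\}$, viewed in this way; equivalently (up to $\leq_{\mathrm{LT}}$ in both directions) with a function $\omega\to\omega$. **LT-game and $\leq_{\mathrm{LT}}$.** Fix a computable bijection $\langle-,-\rangle\colon\omega^2\to\omega$. For upper sequences $\overline{\mathcal U}=(\mathcal U_i)_{i\in I}$,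 $\overline{\mathcal V}=(\mathcal V_j)_{j\in J}$, the game $\mathfrak G(\overline{\mathcal U},\overline{\mathcal V})$ has players Merlin versus the team Arthur–Nimue. Merlin first chooses $x_0\in I$ and $A\in\mathcal U_{x_0}$. At round $n=0,1,\dots$ Arthur plays either $\langle1,u_n\rangle$, terminating the game with output $u_n$, or $\langle0,u_n\rangle$ with $u_n\in J$ (a query); after a query Nimue chooses $B_n\in\mathcal V_{u_n}$ and Merlin replies with $x_{n+1}\in B_n$. Arthur sees only $x_0,\dots,x_n$, and his strategy is a partial computable function $\omega^{<\omega}\rightharpoonup\omega$; Nimue sees the whole history and her strategy is arbitrary. The Arthur–Nimue strategy wins if every play following it terminates legally (after finitely many rounds) with output in $A$, or Merlin violates the rules first. $\overline{\mathcal U}\leq_{\mathrm{LT}}\overline{\mathcal V}$ iff Arthur–Nimue have a winning strategy in $\mathfrak G(\overline{\mathcal U},\overline{\mathcal V})$. *)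

theory Defs
  imports "HOL-Analysis.Infinite_Sum" "HOL-Library.Nat_Bijection" "HOL-Library.Indicator_Function"
begin

section \<open>Partial computable functions\<close>

text \<open>
  Kleene's partial recursive functions. The projection \<open>Proj i\<close> counts from 0; in
  \<open>PrimRec f g\<close> the recursion variable is the first argument, and \<open>g\<close> receives the previous
  value, the predecessor of the recursion variable, and the parameters. No arity discipline is
  imposed on terms: a term applied to a list of unsuitable length either ignores the superfluous
  arguments or is undefined, so on lists of any fixed length the functions obtained are
  exactly the partial recursive functions of that arity.
\<close>

datatype recf =
    Zero
  | Succ
  | Proj nat
  | Comp recf "recf list"
  | PrimRec recf recf
  | Mu recf

fun eval :: "recf \<Rightarrow> nat list \<Rightarrow> nat option" where
  "eval Zero xs = Some 0"
| "eval Succ xs = (case xs of [x] \<Rightarrow> Some (Suc x) | _ \<Rightarrow> None)"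
| "eval (Proj i) xs = (if i < length xs then Some (xs ! i) else None)"
| "eval (Comp f gs) xs = Option.bind (those (map (\<lambda>g. eval g xs) gs)) (eval f)"
| "eval (PrimRec f g) xs =
     (case xs of
        [] \<Rightarrow> None
      | n # ys \<Rightarrow> rec_nat (eval f ys) (\<lambda>m r. Option.bind r (\<lambda>y. eval g (y # m # ys))) n)"
| "eval (Mu f) xs =
     (if \<exists>n. eval f (n # xs) = Some 0 \<and> (\<forall>i<n. \<exists>y. eval f (i # xs) = Some (Suc y))
      then Some (LEAST n. eval f (n # xs) = Some 0) else None)"

text \<open>
  Finite sequences are coded by the computable bijection \<^const>\<open>list_encode\<close>.
\<close>

definition partial_computable :: "(nat list \<rightharpoonup> nat) \<Rightarrow> bool" where
  "partial_computable \<alpha> \<longleftrightarrow> (\<exists>p. \<forall>xs. \<alpha> xs = eval p [list_encode xs])"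


section \<open>Upper sets, filters, ideals\<close>

definition upper_set :: "nat set set \<Rightarrow> bool" where
  "upper_set \<U> \<longleftrightarrow> \<U> \<noteq> {} \<and> (\<forall>A\<in>\<U>. \<forall>B. A \<subseteq> B \<longrightarrow> B \<in> \<U>) \<and> {} \<notin> \<U>"

definition set_filter :: "nat set set \<Rightarrow> bool" where
  "set_filter \<F> \<longleftrightarrow> upper_set \<F> \<and> (\<forall>A\<in>\<F>. \<forall>B\<in>\<F>. A \<inter> B \<in> \<F>)"

definition dual :: "nat set set \<Rightarrow> nat set set" where
  "dual \<I> = {- A | A. A \<in> \<I>}"

definition set_ideal :: "nat set set \<Rightarrow> bool" where
  "set_ideal \<I> \<longleftrightarrow> set_filter (dual \<I>)"

definition Sum_ideal :: "(nat \<Rightarrow> real) \<Rightarrow> nat set set" where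
  "Sum_ideal g = {A. g summable_on A}"

text \<open>
  Since \<^const>\<open>set_ideal\<close> only allows proper ideals, the sum of \<open>g\<close> over all of \<open>\<omega>\<close> diverges.
\<close>

definition summable_ideal :: "nat set set \<Rightarrow> bool" where
  "summable_ideal \<I> \<longleftrightarrow> set_ideal \<I> \<and> (\<exists>g. (\<forall>n. 0 \<le> g n) \<and> \<I> = Sum_ideal g)"


section \<open>Upper sequences\<close>

text \<open>A family indexed by \<open>I \<subseteq> \<omega>\<close> is a partial map with domain \<open>I\<close>.\<close>

type_synonym useq = "nat \<rightharpoonup> nat set set"

definition upper_sequence :: "useq \<Rightarrow> bool" where
  "upper_sequence U \<longleftrightarrow> (\<forall>\<U>\<in>ran U. upper_set \<U>)"

definition useq_of_set :: "nat set set \<Rightarrow> useq" where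
  "useq_of_set \<U> = [0 \<mapsto> \<U>]"

definition useq_of_fun :: "(nat \<Rightarrow> nat) \<Rightarrow> useq" where
  "useq_of_fun f = (\<lambda>n. Some {A. f n \<in> A})"

definition turing_degree_topology :: "useq \<Rightarrow> bool" where
  "turing_degree_topology k \<longleftrightarrow> (\<exists>X :: nat set. k = useq_of_fun (indicator X))"

lemma upper_sequence_useq_of_set: "upper_set \<U> \<Longrightarrow> upper_sequence (useq_of_set \<U>)"
  by (simp add: upper_sequence_def useq_of_set_def)

lemma upper_sequence_useq_of_fun: "upper_sequence (useq_of_fun f)"
  by (auto simp: upper_sequence_def useq_of_fun_def upper_set_def ran_def)


section \<open>The game\<close>

text \<open>
  Merlin plays a set \<open>A\<close> and numbers \<open>x 0, x 1, \<dots>\<close>. Arthur's strategy \<open>\<alpha>\<close> sees only the numbers.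
  Nimue's strategy \<open>\<nu>\<close> sees \<open>A\<close>, the list of completed rounds (Merlin's number, Arthur's move,
  Nimue's set), and Merlin's number and Arthur's move of the current round. Arthur's moves are
  coded by the computable bijection \<^const>\<open>prod_encode\<close>.
\<close>

type_synonym arthur = "nat list \<rightharpoonup> nat"
type_synonym nimue = "nat set \<Rightarrow> (nat \<times> nat \<times> nat set) list \<Rightarrow> nat \<Rightarrow> nat \<Rightarrow> nat set"

definition arthur_move :: "arthur \<Rightarrow> (nat \<Rightarrow> nat) \<Rightarrow> nat \<Rightarrow> nat option" where
  "arthur_move \<alpha> x n = \<alpha> (map x [0..<Suc n])"

text \<open>
  Below, \<^const>\<open>the\<close> is harmless: the winning condition inspects Nimue's move in a round
  only if Arthur's moves up to and including that round are defined.
\<close>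

primrec rounds :: "arthur \<Rightarrow> nimue \<Rightarrow> nat set \<Rightarrow> (nat \<Rightarrow> nat) \<Rightarrow> nat \<Rightarrow> (nat \<times> nat \<times> nat set) list"
  where
  "rounds \<alpha> \<nu> A x 0 = []"
| "rounds \<alpha> \<nu> A x (Suc n) =
     (let h = rounds \<alpha> \<nu> A x n; w = the (arthur_move \<alpha> x n) in h @ [(x n, w, \<nu> A h (x n) w)])"

definition nimue_move :: "arthur \<Rightarrow> nimue \<Rightarrow> nat set \<Rightarrow> (nat \<Rightarrow> nat) \<Rightarrow> nat \<Rightarrow> nat set" where
  "nimue_move \<alpha> \<nu> A x n = \<nu> A (rounds \<alpha> \<nu> A x n) (x n) (the (arthur_move \<alpha> x n))"

definition legal_query :: "useq \<Rightarrow> arthur \<Rightarrow> nimue \<Rightarrow> nat set \<Rightarrow> (nat \<Rightarrow> nat) \<Rightarrow> nat \<Rightarrow> bool" where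
  "legal_query V \<alpha> \<nu> A x n \<longleftrightarrow>
     (\<exists>u \<V>. arthur_move \<alpha> x n = Some (prod_encode (0, u)) \<and> V u = Some \<V> \<and>
        nimue_move \<alpha> \<nu> A x n \<in> \<V>)"

definition outputs_in :: "arthur \<Rightarrow> nat set \<Rightarrow> (nat \<Rightarrow> nat) \<Rightarrow> nat \<Rightarrow> bool" where
  "outputs_in \<alpha> A x n \<longleftrightarrow> (\<exists>u\<in>A. arthur_move \<alpha> x n = Some (prod_encode (1, u)))"

text \<open>
  Against every legal opening of Merlin, play proceeds legally up to some round \<open>n\<close>, in which
  either Arthur terminates correctly or Merlin is the first to break a rule. Merlin's moves are
  given as an infinite sequence, of which the entries after the end of the play are not used.
\<close>

definition winning :: "useq \<Rightarrow> useq \<Rightarrow> arthur \<Rightarrow> nimue \<Rightarrow> bool" where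
  "winning U V \<alpha> \<nu> \<longleftrightarrow>
     (\<forall>x A. (\<exists>\<U>. U (x 0) = Some \<U> \<and> A \<in> \<U>) \<longrightarrow>
        (\<exists>n. (\<forall>i<n. legal_query V \<alpha> \<nu> A x i \<and> x (Suc i) \<in> nimue_move \<alpha> \<nu> A x i) \<and>
             (outputs_in \<alpha> A x n \<or>
              legal_query V \<alpha> \<nu> A x n \<and> x (Suc n) \<notin> nimue_move \<alpha> \<nu> A x n)))"

definition le_LT :: "useq \<Rightarrow> useq \<Rightarrow> bool"  (infix "\<le>\<^sub>L\<^sub>T" 50) where
  "U \<le>\<^sub>L\<^sub>T V \<longleftrightarrow> (\<exists>\<alpha> \<nu>. partial_computable \<alpha> \<and> winning U V \<alpha> \<nu>)"

end

theory Submission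
  imports Defs "HOL-Library.Countable_Set"
begin

text \<open>
  The two halves are independent.

  A function \<open>f\<close> reduces to a filter as soon as almost every number, in the sense of the filter,
  contains enough information about \<open>f\<close>. So let \<open>C\<close> be the set of codes of the initial segments
  \<open>f 0, \<dots>, f (m - 1)\<close>, and give weight 1 to the elements of \<open>C\<close> and weight 0 to all other numbers.
  The sets of finite sum are those that meet \<open>C\<close> in a finite set, and they form a proper ideal
  because \<open>C\<close> is infinite. If Merlin opens with \<open>n\<close>, Nimue makes him answer with the code of an
  initial segment longer than \<open>n\<close>; this excludes only finitely many elements of \<open>C\<close>. Arthur reads off
  entry \<open>n\<close>, so one query suffices, and one strategy serves every \<open>f\<close>. Since
  computability means having a term for a partial recursive function, the decoding of lists has to
  be shown recursive (\<open>lookup_strategy\<close>); \<open>fun_le_LT_summable\<close> is the resulting reduction.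

  Conversely, no filter \<open>\<F>\<close> lies above all degrees, because a strategy of Arthur determines the
  function that it reduces to \<open>\<F>\<close> (\<open>strategy_determines_fun\<close>). If the same strategy, helped by two
  different Nimues, reduced both \<open>f\<close> and \<open>g\<close> to \<open>\<F>\<close>, then Merlin could start both games with the same
  \<open>n\<close> and always answer with an element of the intersection of the two sets offered, which
  belongs to the filter and so is nonempty. Arthur sees the same numbers in both games, hence gives the same
  output, and \<open>f n = g n\<close>. As there are only countably many computable strategies, only countably
  many decision problems can be reduced to \<open>\<F>\<close> (\<open>no_filter_above_all_degrees\<close>).
\<close>

section \<open>A calculus of total recursive functions\<close>

text \<open>
  The arity is fixed because terms applied to lists of another length may be undefined. Functions
  of lists, rather than of a tuple of numbers, let all closure properties below have the form
  in which the introduction method can decompose an expression in the entries \<open>xs ! i\<close>.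
\<close>

definition recursive :: "nat \<Rightarrow> (nat list \<Rightarrow> nat) \<Rightarrow> bool" where
  "recursive k F \<longleftrightarrow> (\<exists>p. \<forall>xs. length xs = k \<longrightarrow> eval p xs = Some (F xs))"

lemma those_map_Some: "(\<And>y. y \<in> set ys \<Longrightarrow> h y = Some (H y)) \<Longrightarrow> those (map h ys) = Some (map H ys)"
  by (induction ys) auto

lemma recursive_const: "recursive k (\<lambda>_. c)"
proof (induction c)
  case 0
  show ?case unfolding recursive_def by (rule exI[of _ Zero]) simp
next
  case (Suc c)
  then obtain p where p: "\<And>xs. length xs = k \<Longrightarrow> eval p xs = Some c"
    unfolding recursive_def by blast
  show ?case unfolding recursive_def by (rule exI[of _ "Comp Succ [p]"]) (simp add: p)
qed

lemma recursive_nth: "i < k \<Longrightarrow> recursive k (\<lambda>xs. xs ! i)"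
  unfolding recursive_def by (rule exI[of _ "Proj i"]) simp

lemma recursive_Suc:
  assumes "recursive k a"
  shows "recursive k (\<lambda>xs. Suc (a xs))"
proof -
  obtain p where p: "\<And>xs. length xs = k \<Longrightarrow> eval p xs = Some (a xs)"
    using assms unfolding recursive_def by blast
  show ?thesis unfolding recursive_def by (rule exI[of _ "Comp Succ [p]"]) (simp add: p)
qed

text \<open>
  The step function of a primitive recursion receives the previous value and the counter in
  front of the parameters. This lets an expression in the parameters be used inside such a step.
\<close>

lemma recursive_drop2:
  assumes "recursive k a"
  shows "recursive (k + 2) (\<lambda>xs. a (drop 2 xs))"
proof -
  obtain p where p: "\<And>xs. length xs = k \<Longrightarrow> eval p xs = Some (a xs)"
    using assms unfolding recursive_def by blast
  have "those (map (\<lambda>q. eval q xs) (map Proj [2..<k + 2])) = Some (drop 2 xs)"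
    if len: "length xs = k + 2" for xs
  proof -
    have "those (map (\<lambda>i. eval (Proj i) xs) [2..<k + 2]) = Some (map ((!) xs) [2..<k + 2])"
      by (rule those_map_Some) (use len in auto)
    also have "map ((!) xs) [2..<k + 2] = drop 2 xs"
      by (rule nth_equalityI) (use len in \<open>auto simp del: upt_Suc upt_conv_Cons\<close>)
    finally show ?thesis by (simp add: comp_def del: eval.simps)
  qed
  then show ?thesis unfolding recursive_def
    by (intro exI[of _ "Comp p (map Proj [2..<k + 2])"]) (simp add: p del: upt_Suc)
qed

text \<open>
  Recursion up to a bound that is itself an expression in the parameters: the term for the
  recursion is composed with the bound and with all projections, which pass on the parameters.
\<close>

lemma recursive_rec_nat:
  assumes "recursive k a" and "recursive (k + 2) b" and "recursive k c"
  shows "recursive k (\<lambda>xs. rec_nat (a xs) (\<lambda>m r. b (r # m # xs)) (c xs))"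
proof -
  obtain p where p: "\<And>xs. length xs = k \<Longrightarrow> eval p xs = Some (a xs)"
    using assms unfolding recursive_def by blast
  obtain q where q: "\<And>xs. length xs = k + 2 \<Longrightarrow> eval q xs = Some (b xs)"
    using assms unfolding recursive_def by blast
  obtain s where s: "\<And>xs. length xs = k \<Longrightarrow> eval s xs = Some (c xs)"
    using assms unfolding recursive_def by blast
  have proj: "those (map (\<lambda>q. eval q xs) (map Proj [0..<k])) = Some xs"
    if len: "length xs = k" for xs
  proof -
    have "those (map (\<lambda>i. eval (Proj i) xs) [0..<k]) = Some (map ((!) xs) [0..<k])"
      by (rule those_map_Some) (use len in auto)
    then show ?thesis using map_nth[of xs] len by (simp add: comp_def del: eval.simps)
  qed
  have rec: "eval (PrimRec p q) (n # xs) = Some (rec_nat (a xs) (\<lambda>m r. b (r # m # xs)) n)"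
    if "length xs = k" for n xs
    by (induction n) (simp_all add: p q that)
  show ?thesis unfolding recursive_def
  proof (intro exI[of _ "Comp (PrimRec p q) (s # map Proj [0..<k])"] allI impI)
    fix xs :: "nat list"
    assume len: "length xs = k"
    have "those (map (\<lambda>g. eval g xs) (s # map Proj [0..<k])) = Some (c xs # xs)"
      using proj[OF len] s[OF len] by (simp del: eval.simps)
    then show "eval (Comp (PrimRec p q) (s # map Proj [0..<k])) xs
        = Some (rec_nat (a xs) (\<lambda>m r. b (r # m # xs)) (c xs))"
      using rec[OF len, of "c xs"] by (simp only: eval.simps(4) bind.bind_lunit)
  qed
qed

lemma recursive_add:
  assumes "recursive k a" and "recursive k b"
  shows "recursive k (\<lambda>xs. a xs + b xs)"
proof -
  have "rec_nat m (\<lambda>_ r. Suc r) n = m + n" for m n :: nat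
    by (induction n) auto
  then show ?thesis
    using recursive_rec_nat[OF assms(1) recursive_Suc[OF recursive_nth[of 0]] assms(2)] by simp
qed

lemma recursive_pred:
  assumes "recursive k a"
  shows "recursive k (\<lambda>xs. a xs - 1)"
proof -
  have "rec_nat 0 (\<lambda>m _. m) n = n - 1" for n :: nat
    by (cases n) auto
  then show ?thesis
    using recursive_rec_nat[OF recursive_const[of k 0] recursive_nth[of 1] assms] by simp
qed

lemma recursive_diff:
  assumes "recursive k a" and "recursive k b"
  shows "recursive k (\<lambda>xs. a xs - b xs)"
proof -
  have "rec_nat m (\<lambda>_ r. r - 1) n = m - n" for m n :: nat
    by (induction n) auto
  then show ?thesis
    using recursive_rec_nat[OF assms(1) recursive_pred[OF recursive_nth[of 0]] assms(2)] by simp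
qed

lemma recursive_if_zero:
  assumes "recursive k a" and "recursive k b" and "recursive k c"
  shows "recursive k (\<lambda>xs. if a xs = 0 then b xs else c xs)"
proof -
  have "rec_nat m (\<lambda>_ _. m') n = (if n = 0 then m else m')" for m m' n :: nat
    by (cases n) auto
  then show ?thesis
    using recursive_rec_nat[OF assms(2) recursive_drop2[OF assms(3)] assms(1)] by simp
qed

lemma recursive_triangle:
  assumes "recursive k a"
  shows "recursive k (\<lambda>xs. triangle (a xs))"
proof -
  have "rec_nat 0 (\<lambda>m r. r + Suc m) n = triangle n" for n
    by (induction n) auto
  moreover have "recursive (k + 2) (\<lambda>xs. xs ! 0 + Suc (xs ! 1))"
    by (intro recursive_add recursive_Suc recursive_nth) auto
  ultimately show ?thesis
    using recursive_rec_nat[OF recursive_const[of k 0] _ assms] by fastforce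
qed

section \<open>Decoding pairs and lists\<close>

text \<open>
  The pairing function enumerates the diagonals \<open>a + b = s\<close> one after the other. A
  primitive recursion has a single number as its value, so it cannot step through the pairs
  themselves, but it can keep track of the diagonal, from which both components
  are recovered arithmetically.
\<close>

definition diagonal :: "nat \<Rightarrow> nat" where
  "diagonal z = fst (prod_decode z) + snd (prod_decode z)"

lemma diagonal_prod_encode: "diagonal (prod_encode (a, b)) = a + b"
  by (simp add: diagonal_def)

lemma triangle_diagonal: "z = triangle (diagonal z) + fst (prod_decode z)"
  using prod_decode_inverse[of z]
  by (simp add: diagonal_def prod_encode_def case_prod_beta)

text \<open>
  The next number starts a new diagonal exactly if it reaches the next triangular number; the
  test is written as a vanishing truncated difference to match \<open>recursive_if_zero\<close>.
\<close>

lemma diagonal_Suc: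
  "diagonal (Suc z) = (if triangle (Suc (diagonal z)) - Suc z = 0 then Suc (diagonal z) else diagonal z)"
proof -
  obtain a b where z: "z = prod_encode (a, b)"
    by (metis prod_decode_inverse surj_pair)
  show ?thesis
  proof (cases b)
    case 0
    have "Suc z = prod_encode (0, Suc a)" by (simp add: z 0 prod_encode_def)
    then have "diagonal (Suc z) = Suc a" by (simp only: diagonal_prod_encode)
    then show ?thesis by (simp add: z 0 diagonal_prod_encode) (simp add: prod_encode_def)
  next
    case (Suc b')
    have "Suc z = prod_encode (Suc a, b')" by (simp add: z Suc prod_encode_def)
    then have "diagonal (Suc z) = Suc a + b'" by (simp only: diagonal_prod_encode)
    then show ?thesis by (simp add: z Suc diagonal_prod_encode) (simp add: prod_encode_def)
  qed
qed

lemma recursive_diagonal: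
  assumes "recursive k a"
  shows "recursive k (\<lambda>xs. diagonal (a xs))"
proof -
  have "rec_nat 0 (\<lambda>m r. if triangle (Suc r) - Suc m = 0 then Suc r else r) n = diagonal n" for n
  proof (induction n)
    case 0
    show ?case using diagonal_prod_encode[of 0 0] by (simp add: prod_encode_def)
  next
    case (Suc n)
    then show ?case by (simp only: diagonal_Suc nat.rec)
  qed
  moreover have "recursive (k + 2)
      (\<lambda>xs. if triangle (Suc (xs ! 0)) - Suc (xs ! 1) = 0 then Suc (xs ! 0) else xs ! 0)"
    by (intro recursive_if_zero recursive_diff recursive_triangle recursive_Suc recursive_nth) auto
  note recursive_rec_nat[OF recursive_const[of k 0] this assms]
  ultimately show ?thesis by (simp only: nth_Cons_0 nth_Cons_Suc One_nat_def)
qed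

lemma recursive_fst_decode:
  assumes "recursive k a"
  shows "recursive k (\<lambda>xs. fst (prod_decode (a xs)))"
proof -
  have eq: "fst (prod_decode z) = z - triangle (diagonal z)" for z
    by (subst (2) triangle_diagonal) simp
  show ?thesis
    unfolding eq by (intro recursive_diff recursive_triangle recursive_diagonal assms)
qed

lemma recursive_snd_decode:
  assumes "recursive k a"
  shows "recursive k (\<lambda>xs. snd (prod_decode (a xs)))"
proof -
  have eq: "snd (prod_decode z) = diagonal z - fst (prod_decode z)" for z
    by (simp add: diagonal_def)
  show ?thesis
    unfolding eq by (intro recursive_diff recursive_fst_decode recursive_diagonal assms)
qed

text \<open>
  A nonempty list is coded as the successor of a pair, hence the predecessor. On the code 0 of
  the empty list these functions return 0, the components of the pair with code 0.
\<close>

definition code_hd :: "nat \<Rightarrow> nat" where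
  "code_hd c = fst (prod_decode (c - 1))"

definition code_tl :: "nat \<Rightarrow> nat" where
  "code_tl c = snd (prod_decode (c - 1))"

definition code_nth :: "nat \<Rightarrow> nat \<Rightarrow> nat" where
  "code_nth c i = code_hd ((code_tl ^^ i) c)"

lemma code_hd_Cons [simp]: "code_hd (list_encode (x # xs)) = x"
  and code_tl_Cons [simp]: "code_tl (list_encode (x # xs)) = list_encode xs"
  by (simp_all add: code_hd_def code_tl_def)

lemma code_nth_list_encode: "i < length xs \<Longrightarrow> code_nth (list_encode xs) i = xs ! i"
proof (induction xs arbitrary: i)
  case (Cons x xs)
  then show ?case
    by (cases i) (simp_all add: code_nth_def funpow_Suc_right del: funpow.simps list_encode.simps)
qed simp

lemma recursive_code_tl: "recursive k a \<Longrightarrow> recursive k (\<lambda>xs. code_tl (a xs))"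
  unfolding code_tl_def by (intro recursive_snd_decode recursive_pred)

lemma recursive_code_nth:
  assumes "recursive k a" and "recursive k b"
  shows "recursive k (\<lambda>xs. code_nth (a xs) (b xs))"
proof -
  have "rec_nat c (\<lambda>_ r. code_tl r) n = (code_tl ^^ n) c" for c n
    by (induction n) auto
  then have "recursive k (\<lambda>xs. (code_tl ^^ b xs) (a xs))"
    using recursive_rec_nat[OF assms(1) recursive_code_tl[OF recursive_nth[of 0]] assms(2)] by simp
  then show ?thesis
    unfolding code_nth_def code_hd_def by (intro recursive_fst_decode recursive_pred)
qed

section \<open>Reducing a function to a summable filter\<close>

text \<open>
  Arthur's strategy: on one number make the query 0, on two numbers \<open>n\<close> and \<open>c\<close> output the
  \<open>n\<close>-th entry of the list coded by \<open>c\<close>. The code of the numbers seen has tail 0 if it has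
  length 1.
\<close>

lemma lookup_strategy:
  obtains \<alpha> where "partial_computable \<alpha>"
    and "\<And>n. \<alpha> [n] = Some (prod_encode (0, 0))"
    and "\<And>n s. n < length s \<Longrightarrow> \<alpha> [n, list_encode s] = Some (prod_encode (1, s ! n))"
proof -
  \<comment> \<open>\<open>prod_encode (0, 0) = 0\<close> and \<open>prod_encode (1, u) = triangle (Suc u) + 1\<close>\<close>
  define H where "H c = (if code_tl c = 0 then 0
      else triangle (Suc (code_nth (code_nth c 1) (code_nth c 0))) + 1)" for c
  have "recursive 1 (\<lambda>xs. H (xs ! 0))"
    unfolding H_def
    by (intro recursive_if_zero recursive_code_tl recursive_add recursive_triangle recursive_Suc
        recursive_code_nth recursive_const recursive_nth) auto
  then obtain p where p: "\<And>xs. length xs = 1 \<Longrightarrow> eval p xs = Some (H (xs ! 0))"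
    unfolding recursive_def by blast
  show ?thesis
  proof
    show "partial_computable (\<lambda>xs. eval p [list_encode xs])"
      unfolding partial_computable_def by blast
    show "eval p [list_encode [n]] = Some (prod_encode (0, 0))" for n
      using code_tl_Cons[of n "[]"] by (simp add: p H_def prod_encode_def del: code_tl_Cons)
    show "eval p [list_encode [n, list_encode s]] = Some (prod_encode (1, s ! n))"
      if "n < length s" for n s
    proof -
      let ?c = "list_encode [n, list_encode s]"
      have "code_tl ?c \<noteq> 0" by (subst code_tl_Cons) simp
      moreover have "code_nth ?c 0 = n" "code_nth ?c 1 = list_encode s"
        by (simp_all add: code_nth_list_encode del: list_encode.simps)
      ultimately show ?thesis
        using that by (simp add: p H_def code_nth_list_encode prod_encode_def del: list_encode.simps)
    qed
  qed
qed

lemma Sum_ideal_indicator: "Sum_ideal (indicator C) = {A. finite (A \<inter> C)}"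
proof -
  have "(indicator C :: nat \<Rightarrow> real) summable_on A \<longleftrightarrow> finite (A \<inter> C)" for A
  proof -
    have "(indicator C :: nat \<Rightarrow> real) summable_on A \<longleftrightarrow> (\<lambda>_. 1 :: real) summable_on (A \<inter> C)"
      by (rule summable_on_cong_neutral) auto
    also have "\<dots> \<longleftrightarrow> finite (A \<inter> C)"
      using infsum_diverge_constant[of "A \<inter> C" "1 :: real"] by auto
    finally show ?thesis .
  qed
  then show ?thesis by (simp add: Sum_ideal_def)
qed

lemma dual_Sum_ideal_indicator: "dual (Sum_ideal (indicator C)) = {B. finite (C - B)}"
proof -
  have "B \<in> dual (Sum_ideal (indicator C)) \<longleftrightarrow> - B \<in> Sum_ideal (indicator C)" for B
    unfolding dual_def by (auto intro: exI[of _ "- B"])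
  moreover have "- B \<inter> C = C - B" for B by blast
  ultimately show ?thesis by (auto simp: Sum_ideal_indicator)
qed

lemma summable_ideal_indicator:
  assumes "infinite C"
  shows "summable_ideal (Sum_ideal (indicator C))"
proof -
  have "set_filter {B. finite (C - B)}"
    unfolding set_filter_def upper_set_def mem_Collect_eq
  proof (intro conjI ballI allI impI)
    show "{B. finite (C - B)} \<noteq> {}" by (auto intro: exI[of _ C])
    show "\<not> finite (C - {})" using assms by simp
    show "finite (C - B)" if "A \<in> {B. finite (C - B)}" "A \<subseteq> B" for A B
      using that by (auto elim: rev_finite_subset)
    show "finite (C - A \<inter> B)"
      if "A \<in> {B. finite (C - B)}" "B \<in> {B. finite (C - B)}" for A B
      using that by (simp add: Diff_Int)
  qed
  moreover have "0 \<le> (indicator C n :: real)" for n by simp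
  ultimately show ?thesis
    unfolding summable_ideal_def set_ideal_def dual_Sum_ideal_indicator by blast
qed

proposition fun_le_LT_summable:
  fixes f :: "nat \<Rightarrow> nat"
  shows "\<exists>\<I>. summable_ideal \<I> \<and> useq_of_fun f \<le>\<^sub>L\<^sub>T useq_of_set (dual \<I>)"
proof -
  define c where "c m = list_encode (map f [0..<m])" for m
  \<comment> \<open>codes of different initial segments differ, because the lengths do\<close>
  have inj: "inj c"
    unfolding c_def by (rule injI) (metis diff_zero length_map length_upt list_encode_eq)
  define \<I> where "\<I> = Sum_ideal (indicator (range c))"
  have "summable_ideal \<I>"
    unfolding \<I>_def by (rule summable_ideal_indicator) (rule range_inj_infinite[OF inj])
  moreover have "useq_of_fun f \<le>\<^sub>L\<^sub>T useq_of_set (dual \<I>)"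
  proof -
    obtain \<alpha> where comp: "partial_computable \<alpha>"
      and query: "\<And>n. \<alpha> [n] = Some (prod_encode (0, 0))"
      and answer: "\<And>n s. n < length s \<Longrightarrow> \<alpha> [n, list_encode s] = Some (prod_encode (1, s ! n))"
      by (rule lookup_strategy) blast
    define \<nu> :: nimue where "\<nu> A h n w = c ` {n<..}" for A h n w
    have large: "c ` {n<..} \<in> dual \<I>" for n
    proof -
      have "range c - c ` {n<..} \<subseteq> c ` {..n}" by force
      then show ?thesis
        unfolding \<I>_def dual_Sum_ideal_indicator by (auto intro: finite_subset)
    qed
    have "winning (useq_of_fun f) (useq_of_set (dual \<I>)) \<alpha> \<nu>"
      unfolding winning_def
    proof (intro allI impI)
      fix x :: "nat \<Rightarrow> nat" and A
      assume "\<exists>\<U>. useq_of_fun f (x 0) = Some \<U> \<and> A \<in> \<U>"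
      then have A: "f (x 0) \<in> A" by (auto simp: useq_of_fun_def)
      have nim: "nimue_move \<alpha> \<nu> A x 0 = c ` {x 0<..}"
        by (simp add: nimue_move_def \<nu>_def)
      have legal: "legal_query (useq_of_set (dual \<I>)) \<alpha> \<nu> A x 0"
        using large by (auto simp: legal_query_def nim arthur_move_def query useq_of_set_def)
      show "\<exists>n. (\<forall>i<n. legal_query (useq_of_set (dual \<I>)) \<alpha> \<nu> A x i \<and>
            x (Suc i) \<in> nimue_move \<alpha> \<nu> A x i) \<and>
          (outputs_in \<alpha> A x n \<or>
            legal_query (useq_of_set (dual \<I>)) \<alpha> \<nu> A x n \<and> x (Suc n) \<notin> nimue_move \<alpha> \<nu> A x n)"
      \<comment> \<open>Merlin either breaks the rules in reply to the only query, or reveals \<open>f (x 0)\<close>.\<close>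
      proof (cases "x 1 \<in> c ` {x 0<..}")
        case False
        then show ?thesis using legal nim by (intro exI[of _ 0]) simp
      next
        case True
        then obtain m where m: "x 0 < m" "x 1 = list_encode (map f [0..<m])"
          by (auto simp: c_def)
        have "\<alpha> [x 0, x 1] = Some (prod_encode (1, f (x 0)))"
          using answer[of "x 0" "map f [0..<m]"] m by simp
        then have "outputs_in \<alpha> A x 1"
          using A by (auto simp: outputs_in_def arthur_move_def)
        then show ?thesis using True legal nim by (intro exI[of _ 1]) simp
      qed
    qed
    with comp show ?thesis unfolding le_LT_def by blast
  qed
  ultimately show ?thesis by blast
qed

section \<open>One strategy computes at most one function over a filter\<close>

lemma rounds_cong:
  "(\<And>i. i < n \<Longrightarrow> x i = y i) \<Longrightarrow> rounds \<alpha> \<nu> A x n = rounds \<alpha> \<nu> A y n"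
proof (induction n)
  case (Suc n)
  then have "map x [0..<Suc n] = map y [0..<Suc n]" by (intro map_cong) auto
  then have "arthur_move \<alpha> x n = arthur_move \<alpha> y n" by (simp only: arthur_move_def)
  with Suc show ?case by simp
qed simp

text \<open>
  Nimue's move depends only on what Merlin has already played. This causality makes it possible
  to construct Merlin's play by recursion.
\<close>

lemma nimue_move_cong:
  assumes "\<And>i. i \<le> n \<Longrightarrow> x i = y i"
  shows "nimue_move \<alpha> \<nu> A x n = nimue_move \<alpha> \<nu> A y n"
proof -
  have "map x [0..<Suc n] = map y [0..<Suc n]" using assms by (intro map_cong) auto
  then have "arthur_move \<alpha> x n = arthur_move \<alpha> y n" by (simp only: arthur_move_def)
  moreover have "rounds \<alpha> \<nu> A x n = rounds \<alpha> \<nu> A y n"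
    using assms by (intro rounds_cong) simp
  ultimately show ?thesis using assms[of n] by (simp add: nimue_move_def)
qed

text \<open>
  Merlin plays two games at once with the same numbers. This is possible because any two sets
  of a filter meet. The condition is stated pointwise, without regard to whether the
  games are still going on, so that it defines an infinite sequence.
\<close>

lemma common_play:
  assumes "set_filter \<F>"
  obtains x :: "nat \<Rightarrow> nat" where "x 0 = n"
    and "\<And>i. nimue_move \<alpha> \<nu> A x i \<in> \<F> \<Longrightarrow> nimue_move \<alpha> \<nu>' A' x i \<in> \<F> \<Longrightarrow>
      x (Suc i) \<in> nimue_move \<alpha> \<nu> A x i \<inter> nimue_move \<alpha> \<nu>' A' x i"
proof -
  define P where "P x i r \<longleftrightarrow> (case i of 0 \<Rightarrow> r = n | Suc j \<Rightarrow>
      nimue_move \<alpha> \<nu> A x j \<in> \<F> \<longrightarrow> nimue_move \<alpha> \<nu>' A' x j \<in> \<F> \<longrightarrow>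
      r \<in> nimue_move \<alpha> \<nu> A x j \<inter> nimue_move \<alpha> \<nu>' A' x j)" for x :: "nat \<Rightarrow> nat" and i and r :: nat
  have "\<exists>x. \<forall>i. P x i (x i)"
  proof (rule dependent_wf_choice[OF wf_less])
    fix x y :: "nat \<Rightarrow> nat" and i r
    assume "\<And>j. (j, i) \<in> {(k, l). k < l} \<Longrightarrow> x j = y j"
    then have eq: "\<And>j. j < i \<Longrightarrow> x j = y j" by simp
    show "P x i r = P y i r"
    proof (cases i)
      case (Suc j)
      have "nimue_move \<alpha> \<nu> A x j = nimue_move \<alpha> \<nu> A y j"
        "nimue_move \<alpha> \<nu>' A' x j = nimue_move \<alpha> \<nu>' A' y j"
        using eq Suc by (auto intro!: nimue_move_cong)
      then show ?thesis by (simp add: P_def Suc)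
    qed (simp add: P_def)
  next
    fix i and x :: "nat \<Rightarrow> nat"
    show "\<exists>r. P x i r"
    proof (cases i)
      case (Suc j)
      have "B \<inter> B' \<noteq> {}" if "B \<in> \<F>" "B' \<in> \<F>" for B B'
        using assms that unfolding set_filter_def upper_set_def by metis
      then show ?thesis unfolding P_def Suc by (simp, blast)
    qed (simp add: P_def)
  qed
  then obtain x where "P x i (x i)" for i by blast
  then have "P x 0 (x 0)" "P x (Suc i) (x (Suc i))" for i by blast+
  then show ?thesis unfolding P_def by (intro that[of x]) auto
qed

text \<open>
  Along a common play, Arthur makes the same moves in both games, so neither game can end
  before the other: an output in one is an output in the other, and Merlin obeys the rules in both.
  With the targets \<open>{f n}\<close> and \<open>{g n}\<close> the common output is both \<open>f n\<close> and \<open>g n\<close>.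
\<close>

lemma strategy_determines_fun:
  assumes \<F>: "set_filter \<F>"
    and f: "winning (useq_of_fun f) (useq_of_set \<F>) \<alpha> \<nu>"
    and g: "winning (useq_of_fun g) (useq_of_set \<F>) \<alpha> \<nu>'"
  shows "f = g"
proof
  fix n
  let ?legal = "\<lambda>\<nu> A. legal_query (useq_of_set \<F>) \<alpha> \<nu> A"
  obtain x where x0: "x 0 = n"
    and x: "\<And>i. nimue_move \<alpha> \<nu> {f n} x i \<in> \<F> \<Longrightarrow> nimue_move \<alpha> \<nu>' {g n} x i \<in> \<F> \<Longrightarrow>
      x (Suc i) \<in> nimue_move \<alpha> \<nu> {f n} x i \<inter> nimue_move \<alpha> \<nu>' {g n} x i"
    using common_play[OF \<F>, of n \<alpha> \<nu> "{f n}" \<nu>' "{g n}"] by metis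
  have obey: "x (Suc i) \<in> nimue_move \<alpha> \<nu> {f n} x i \<inter> nimue_move \<alpha> \<nu>' {g n} x i"
    if "?legal \<nu> {f n} x i" "?legal \<nu>' {g n} x i" for i
    using that by (intro x) (auto simp: legal_query_def useq_of_set_def split: if_splits)
  have no_output: "\<not> outputs_in \<alpha> B x i" if "?legal \<mu> A x i" for \<mu> A B i
    using that by (auto simp: legal_query_def outputs_in_def)
  obtain a where a: "\<And>i. i < a \<Longrightarrow> ?legal \<nu> {f n} x i"
    and a_end: "outputs_in \<alpha> {f n} x a \<or>
      ?legal \<nu> {f n} x a \<and> x (Suc a) \<notin> nimue_move \<alpha> \<nu> {f n} x a"
    using f[unfolded winning_def, rule_format, of x "{f n}"] x0 by (auto simp: useq_of_fun_def)
  obtain b where b: "\<And>i. i < b \<Longrightarrow> ?legal \<nu>' {g n} x i"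
    and b_end: "outputs_in \<alpha> {g n} x b \<or>
      ?legal \<nu>' {g n} x b \<and> x (Suc b) \<notin> nimue_move \<alpha> \<nu>' {g n} x b"
    using g[unfolded winning_def, rule_format, of x "{g n}"] x0 by (auto simp: useq_of_fun_def)
  have "\<not> a < b"
    using a_end b[of a] no_output obey by blast
  moreover have "\<not> b < a"
    using b_end a[of b] no_output obey by blast
  ultimately have "a = b" by simp
  then have "outputs_in \<alpha> {f n} x a" "outputs_in \<alpha> {g n} x a"
    using a_end b_end no_output obey by blast+
  then show "f n = g n" by (auto simp: outputs_in_def)
qed

section \<open>Counting strategies\<close>

instance recf :: countable
  by countable_datatype

lemma countable_partial_computable: "countable {\<alpha>. partial_computable \<alpha>}"
proof -
  have "{\<alpha>. partial_computable \<alpha>} = range (\<lambda>p xs. eval p [list_encode xs])"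
    by (auto simp: partial_computable_def fun_eq_iff)
  then show ?thesis by simp
qed

proposition no_filter_above_all_degrees:
  assumes \<F>: "set_filter \<F>"
  shows "\<exists>k. turing_degree_topology k \<and> \<not> k \<le>\<^sub>L\<^sub>T useq_of_set \<F>"
proof (rule ccontr)
  assume "\<not> ?thesis"
  then have "useq_of_fun (indicator X) \<le>\<^sub>L\<^sub>T useq_of_set \<F>" for X
    unfolding turing_degree_topology_def by blast
  then have "\<exists>\<alpha>. partial_computable \<alpha> \<and>
      (\<exists>\<nu>. winning (useq_of_fun (indicator X)) (useq_of_set \<F>) \<alpha> \<nu>)" for X
    unfolding le_LT_def by blast
  then obtain s where s: "\<And>X. partial_computable (s X)"
    and win: "\<And>X. \<exists>\<nu>. winning (useq_of_fun (indicator X)) (useq_of_set \<F>) (s X) \<nu>"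
    by metis
  have "inj s"
  proof (rule injI)
    fix X Y
    assume "s X = s Y"
    then have "(indicator X :: nat \<Rightarrow> nat) = indicator Y"
      using win[of X] win[of Y] strategy_determines_fun[OF \<F>] by metis
    then have "(indicator X z :: nat) = 1 \<longleftrightarrow> (indicator Y z :: nat) = 1" for z by simp
    then show "X = Y" unfolding indicator_eq_1_iff by blast
  qed
  moreover have "countable (range s)"
    by (rule countable_subset[OF _ countable_partial_computable]) (use s in auto)
  ultimately have "countable (UNIV :: nat set set)"
    by (metis countable_image_inj_on)
  then obtain h :: "nat \<Rightarrow> nat set" where "range h = UNIV"
    by (metis UNIV_not_empty range_from_nat_into)
  then show False using Cantors_theorem[of UNIV] by (metis Pow_UNIV)
qed

theorem theoremE:
  "(\<forall>f :: nat \<Rightarrow> nat. \<exists>\<I>. summable_ideal \<I> \<and> useq_of_fun f \<le>\<^sub>L\<^sub>T useq_of_set (dual \<I>)) \<and>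
   \<not> (\<exists>\<F>. set_filter \<F> \<and> (\<forall>k. turing_degree_topology k \<longrightarrow> k \<le>\<^sub>L\<^sub>T useq_of_set \<F>))"
  using fun_le_LT_summable no_filter_above_all_degrees by blast

end
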